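(* Let $R$ be a commutative ring whose Jacobson radical contains a regular element $j$ of $R$, and let $W$ be the multiplicative set generated by $j$ and the units of $R$. Then $R$ is strictly $W$-Egyptian (hence also strictly Egyptian). In fact, for every nonzero element $f\in R$, the element $\frac{f}{1}\in W^{-1}R$ can be written as a sum of reciprocals of at most two distinct elements of $W$.
   Context: Rings are commutative with identity. A regular element of $R$ is an element that is not a zero-divisor. A multiplicative set in a ring $R$ is a subset containing $1$ and closed under multiplication; the multiplicative set generated by a subset is the smallest multiplicative set containing it. For a multiplicative set $W\subseteq R$, $W^{-1}R$ denotes the localization. An element $c\in W^{-1}R$ is called strictly $W$-Egyptian if it can be written as a finite (possibly empty) sum $\frac{1}{w_1}+\cdots+\frac{1}{w_n}$ in $W^{-1}R$ of reciprocals of pairwise distinct elements $w_1,\dots,w_n$ of $W$. An element $b\in R$ is strictly $W$-Egyptian if $\frac{b}{1}\in W^{-1}R$ is. The ring $R$ is strictly $W$-Egyptian if every nonzero element of $R$ is strictly $W$-Egyptian. When $W$ is the set of all regular elements of $R$, the prefix is omitted and one says strictly Egyptian. *)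

theory Defs
  imports "HOL-Algebra.Ideal"
begin

text \<open>
  Rings are \<open>cring\<close>s of \<open>HOL-Algebra\<close> (the zero ring is allowed), and a multiplicative set of
  \<open>R\<close> is a \<open>submonoid\<close> of \<open>R\<close>, i.e. a subset of the carrier that contains \<open>\<one>\<close> and is closed
  under multiplication.
\<close>

definition regular_elements :: "('a, 'm) ring_scheme \<Rightarrow> 'a set" where
  "regular_elements R =
     {a \<in> carrier R. \<not> (\<exists>b \<in> carrier R. b \<noteq> \<zero>\<^bsub>R\<^esub> \<and> a \<otimes>\<^bsub>R\<^esub> b = \<zero>\<^bsub>R\<^esub>)}"

text \<open>Intersecting with the carrier matters only for the zero ring, which has no maximal ideal.\<close>

definition jacobson_radical :: "('a, 'm) ring_scheme \<Rightarrow> 'a set" where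
  "jacobson_radical R = carrier R \<inter> \<Inter> {M. maximalideal M R}"

definition generated_mult_set :: "('a, 'm) ring_scheme \<Rightarrow> 'a set \<Rightarrow> 'a set" where
  "generated_mult_set R A = \<Inter> {S. submonoid S R \<and> A \<subseteq> S}"

definition fraction_rel :: "('a, 'm) ring_scheme \<Rightarrow> 'a set \<Rightarrow> (('a \<times> 'a) \<times> ('a \<times> 'a)) set" where
  "fraction_rel R W =
     {((a, s), (b, t)). a \<in> carrier R \<and> s \<in> W \<and> b \<in> carrier R \<and> t \<in> W \<and>
        (\<exists>u \<in> W. u \<otimes>\<^bsub>R\<^esub> (a \<otimes>\<^bsub>R\<^esub> t \<ominus>\<^bsub>R\<^esub> b \<otimes>\<^bsub>R\<^esub> s) = \<zero>\<^bsub>R\<^esub>)}"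

text \<open>\<open>fraction R W a s\<close> is the element $a/s$ of $W^{-1}R$.\<close>

definition fraction :: "('a, 'm) ring_scheme \<Rightarrow> 'a set \<Rightarrow> 'a \<Rightarrow> 'a \<Rightarrow> ('a \<times> 'a) set" where
  "fraction R W a s = fraction_rel R W `` {(a, s)}"

text \<open>
  The operations are given on representatives; for \<open>cring R\<close> and \<open>submonoid W R\<close> the unions
  run over equal classes.
\<close>

definition localization :: "('a, 'm) ring_scheme \<Rightarrow> 'a set \<Rightarrow> ('a \<times> 'a) set ring" where
  "localization R W =
     \<lparr>carrier = (carrier R \<times> W) // fraction_rel R W,
      mult = (\<lambda>C D. \<Union>(a, s) \<in> C. \<Union>(b, t) \<in> D. fraction R W (a \<otimes>\<^bsub>R\<^esub> b) (s \<otimes>\<^bsub>R\<^esub> t)),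
      one = fraction R W \<one>\<^bsub>R\<^esub> \<one>\<^bsub>R\<^esub>,
      zero = fraction R W \<zero>\<^bsub>R\<^esub> \<one>\<^bsub>R\<^esub>,
      add = (\<lambda>C D. \<Union>(a, s) \<in> C. \<Union>(b, t) \<in> D.
               fraction R W (a \<otimes>\<^bsub>R\<^esub> t \<oplus>\<^bsub>R\<^esub> b \<otimes>\<^bsub>R\<^esub> s) (s \<otimes>\<^bsub>R\<^esub> t))\<rparr>"

text \<open>
  The sum \<open>\<Sum>w\<in>S. 1/w\<close> in \<open>localization R W\<close>. A finite list of pairwise distinct elements
  of \<open>W\<close> is encoded by the finite set \<open>S \<subseteq> W\<close> of its members; distinctness refers to elements
  of \<open>R\<close>, not to their images in the localization.
\<close>

definition reciprocal_sum :: "('a, 'm) ring_scheme \<Rightarrow> 'a set \<Rightarrow> 'a set \<Rightarrow> ('a \<times> 'a) set" where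
  "reciprocal_sum R W S = finsum (localization R W) (\<lambda>w. fraction R W \<one>\<^bsub>R\<^esub> w) S"

definition strictly_egyptian_fraction ::
    "('a, 'm) ring_scheme \<Rightarrow> 'a set \<Rightarrow> ('a \<times> 'a) set \<Rightarrow> bool" where
  "strictly_egyptian_fraction R W c \<longleftrightarrow>
     c \<in> carrier (localization R W) \<and> (\<exists>S. finite S \<and> S \<subseteq> W \<and> c = reciprocal_sum R W S)"

definition strictly_egyptian_element :: "('a, 'm) ring_scheme \<Rightarrow> 'a set \<Rightarrow> 'a \<Rightarrow> bool" where
  "strictly_egyptian_element R W b \<longleftrightarrow>
     b \<in> carrier R \<and> strictly_egyptian_fraction R W (fraction R W b \<one>\<^bsub>R\<^esub>)"

definition strictly_egyptian_ring_wrt :: "('a, 'm) ring_scheme \<Rightarrow> 'a set \<Rightarrow> bool" where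
  "strictly_egyptian_ring_wrt R W \<longleftrightarrow>
     (\<forall>b \<in> carrier R. b \<noteq> \<zero>\<^bsub>R\<^esub> \<longrightarrow> strictly_egyptian_element R W b)"

definition strictly_egyptian_ring :: "('a, 'm) ring_scheme \<Rightarrow> bool" where
  "strictly_egyptian_ring R \<longleftrightarrow> strictly_egyptian_ring_wrt R (regular_elements R)"

end

theory Submission
  imports Defs "HOL-Algebra.Ring_Divisibility"
begin

text \<open>
  For \<open>f \<noteq> 0\<close> and \<open>w \<in> W\<close> in the Jacobson radical, \<open>u = 1 + w f\<close> is a unit and
  \<open>f = (1 + w f)/w - 1/w = 1/(w u\<inverse>) + 1/(-w)\<close>. If \<open>w\<close> is regular, the two denominators coincide
  only for \<open>w f = -2\<close>. This cannot happen both for \<open>w = j\<close> and for \<open>w = j\<^sup>2\<close>, since otherwise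
  \<open>j (1 - j) f = 0\<close>, where \<open>j\<close> is regular and \<open>1 - j\<close> is a unit.
\<close>

section \<open>The Jacobson radical\<close>

text \<open>Zorn's lemma on the ideals that contain \<open>I\<close> and avoid
  \<open>\<one>\<close>. Avoiding \<open>\<one>\<close> expresses properness and visibly passes to
  unions of chains.\<close>

lemma (in ring) exists_maximalideal_containing:
  assumes "ideal I R" "\<one> \<notin> I"
  obtains M where "maximalideal M R" "I \<subseteq> M"
proof -
  define A where "A = {J. ideal J R \<and> I \<subseteq> J \<and> \<one> \<notin> J}"
  have "\<exists>M\<in>A. \<forall>X\<in>A. M \<subseteq> X \<longrightarrow> X = M"
  proof (rule subset_Zorn_nonempty)
    show "A \<noteq> {}"
      using assms by (auto simp: A_def)
    fix C assume C: "C \<noteq> {}" "subset.chain A C"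
    then have "subset.chain {J. ideal J R} C"
      unfolding pred_on.chain_def A_def by blast
    \<comment> \<open>Nonemptiness of \<open>C\<close> matters twice: for the union to be an ideal
      and for it to contain \<open>I\<close>.\<close>
    from chain_Union_is_ideal[OF this] C show "\<Union>C \<in> A"
      unfolding pred_on.chain_def A_def by auto
  qed
  then obtain M where M: "M \<in> A" "\<And>X. X \<in> A \<Longrightarrow> M \<subseteq> X \<Longrightarrow> X = M"
    by blast
  have "maximalideal M R"
  proof (rule maximalidealI)
    show "ideal M R" "carrier R \<noteq> M"
      using M(1) by (auto simp: A_def)
    fix J assume J: "ideal J R" "M \<subseteq> J" "J \<subseteq> carrier R"
    show "J = M \<or> J = carrier R"
    proof (cases "\<one> \<in> J")
      case True
      then show ?thesis
        using ideal.one_imp_carrier[OF J(1)] by simp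
    next
      case False
      then show ?thesis
        using M J unfolding A_def by blast
    qed
  qed
  then show ?thesis
    using M(1) that unfolding A_def by blast
qed

lemma (in cring) jacobson_radical_closed:
  "x \<in> jacobson_radical R \<Longrightarrow> x \<in> carrier R"
  by (simp add: jacobson_radical_def)

lemma (in cring) jacobson_radical_mult:
  assumes "x \<in> jacobson_radical R" "a \<in> carrier R"
  shows "x \<otimes> a \<in> jacobson_radical R"
  using assms unfolding jacobson_radical_def maximalideal_def
  by (auto intro: ideal.I_r_closed)

text \<open>If \<open>\<one> \<oplus> x\<close> were not a unit, it would lie in some maximal ideal.
  That ideal also contains \<open>x\<close>, hence the difference \<open>\<one>\<close>, which is
  absurd.\<close>

lemma (in cring) one_plus_jacobson_radical_Units:
  assumes "x \<in> jacobson_radical R"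
  shows "\<one> \<oplus> x \<in> Units R"
proof (rule ccontr)
  have x: "x \<in> carrier R"
    using assms by (rule jacobson_radical_closed)
  assume nonunit: "\<one> \<oplus> x \<notin> Units R"
  have "\<one> \<notin> PIdl (\<one> \<oplus> x)"
  proof
    assume "\<one> \<in> PIdl (\<one> \<oplus> x)"
    then obtain y where y: "y \<in> carrier R" "\<one> = y \<otimes> (\<one> \<oplus> x)"
      unfolding cgenideal_def by blast
    then have "\<one> \<oplus> x \<in> Units R"
      using x m_comm unfolding Units_def by (smt (verit) a_closed mem_Collect_eq one_closed)
    with nonunit show False ..
  qed
  then obtain M where M: "maximalideal M R" "PIdl (\<one> \<oplus> x) \<subseteq> M"
    using exists_maximalideal_containing[OF cgenideal_ideal] x by blast
  interpret M: maximalideal M R by (rule M(1))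
  have "\<one> \<oplus> x \<in> M"
    using M(2) cgenideal_self x by blast
  moreover have "x \<in> M"
    using assms M(1) by (simp add: jacobson_radical_def)
  ultimately have "\<one> \<oplus> x \<ominus> x \<in> M"
    by (simp add: a_minus_def M.a_closed)
  moreover have "\<one> \<oplus> x \<ominus> x = \<one>"
    using x by algebra
  ultimately show False
    using M.one_imp_carrier M.I_notcarr by simp
qed

section \<open>Regular elements\<close>

lemma (in cring) regular_elementsD:
  assumes "a \<in> regular_elements R" "b \<in> carrier R" "a \<otimes> b = \<zero>"
  shows "b = \<zero>"
  using assms by (auto simp: regular_elements_def)

lemma (in cring) regular_elements_closed:
  "a \<in> regular_elements R \<Longrightarrow> a \<in> carrier R"
  by (simp add: regular_elements_def)

lemma (in cring) regular_elements_cancel: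
  assumes "a \<in> regular_elements R" "b \<in> carrier R" "c \<in> carrier R" "a \<otimes> b = a \<otimes> c"
  shows "b = c"
proof -
  have a: "a \<in> carrier R"
    using assms(1) by (rule regular_elements_closed)
  have "a \<otimes> (b \<ominus> c) = a \<otimes> b \<ominus> a \<otimes> c"
    using a assms(2,3) by algebra
  also have "\<dots> = \<zero>"
    using assms a by (simp add: a_minus_def r_neg)
  finally have "b \<ominus> c = \<zero>"
    using regular_elementsD[OF assms(1)] assms(2,3) by simp
  then show ?thesis
    using assms(2,3) by simp
qed

lemma (in cring) Units_subset_regular_elements: "Units R \<subseteq> regular_elements R"
proof
  fix u assume u: "u \<in> Units R"
  have "b = \<zero>" if "b \<in> carrier R" "u \<otimes> b = \<zero>" for b
    using u that Units_l_cancel[of u b \<zero>] by (simp add: Units_closed)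
  then show "u \<in> regular_elements R"
    using u by (auto simp: regular_elements_def)
qed

text \<open>Makes the set of all regular elements a legitimate choice of \<open>W\<close>, as the
  unqualified notion of strictly Egyptian requires.\<close>

lemma (in cring) submonoid_regular_elements: "submonoid (regular_elements R) R"
proof
  show "regular_elements R \<subseteq> carrier R"
    by (auto simp: regular_elements_def)
  show "\<one> \<in> regular_elements R"
    using Units_subset_regular_elements by blast
  fix x y assume xy: "x \<in> regular_elements R" "y \<in> regular_elements R"
  have "b = \<zero>" if "b \<in> carrier R" "x \<otimes> y \<otimes> b = \<zero>" for b
    using that xy regular_elementsD[of y b] regular_elementsD[of x "y \<otimes> b"]
    by (simp add: m_assoc regular_elements_closed)
  then show "x \<otimes> y \<in> regular_elements R"
    using xy by (auto simp: regular_elements_def)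
qed

section \<open>Generated multiplicative sets\<close>

lemma generated_mult_set_superset: "A \<subseteq> generated_mult_set R A"
  by (auto simp: generated_mult_set_def)

lemma generated_mult_set_minimal:
  "submonoid S R \<Longrightarrow> A \<subseteq> S \<Longrightarrow> generated_mult_set R A \<subseteq> S"
  by (auto simp: generated_mult_set_def)

text \<open>The carrier is itself one of the submonoids being intersected, which keeps the
  intersection inside the carrier.\<close>

lemma (in cring) submonoid_generated_mult_set:
  assumes "A \<subseteq> carrier R"
  shows "submonoid (generated_mult_set R A) R"
proof
  have "submonoid (carrier R) R"
    by standard auto
  then show "generated_mult_set R A \<subseteq> carrier R"
    using assms by (rule generated_mult_set_minimal)
qed (auto simp: generated_mult_set_def submonoid_def)

section \<open>The additive monoid of a localization\<close>

text \<open>Sums of reciprocals involve only addition, so only the additive structure of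
  \<open>localization R W\<close> is developed.\<close>

locale cring_mult_set = cring R + submonoid W R for R (structure) and W
begin

text \<open>Moving the subtracted term to the other side turns the proofs about this relation into
  rearrangements of products.\<close>

lemma fraction_rel_iff:
  "((a, s), (b, t)) \<in> fraction_rel R W \<longleftrightarrow>
     a \<in> carrier R \<and> s \<in> W \<and> b \<in> carrier R \<and> t \<in> W \<and>
     (\<exists>u\<in>W. u \<otimes> (a \<otimes> t) = u \<otimes> (b \<otimes> s))"
proof -
  have "u \<otimes> (a \<otimes> t \<ominus> b \<otimes> s) = \<zero> \<longleftrightarrow> u \<otimes> (a \<otimes> t) = u \<otimes> (b \<otimes> s)"
    if "a \<in> carrier R" "s \<in> W" "b \<in> carrier R" "t \<in> W" "u \<in> W" for u
  proof -
    have "u \<otimes> (a \<otimes> t \<ominus> b \<otimes> s) = u \<otimes> (a \<otimes> t) \<ominus> u \<otimes> (b \<otimes> s)"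
      using that(1,3) that(2,4,5)[THEN mem_carrier] by algebra
    then show ?thesis
      using that by simp
  qed
  then show ?thesis
    unfolding fraction_rel_def by auto
qed

lemma equiv_fraction_rel: "equiv (carrier R \<times> W) (fraction_rel R W)"
proof (rule equivI)
  show "fraction_rel R W \<subseteq> (carrier R \<times> W) \<times> (carrier R \<times> W)"
    by (auto simp: fraction_rel_def)
  show "refl_on (carrier R \<times> W) (fraction_rel R W)"
    by (auto simp: refl_on_def fraction_rel_iff intro: one_closed)
  show "sym (fraction_rel R W)"
    by (rule symI) (force simp: fraction_rel_iff)
  show "trans (fraction_rel R W)"
  proof (rule transI)
    fix p q r
    assume "(p, q) \<in> fraction_rel R W" "(q, r) \<in> fraction_rel R W"
    then obtain a s b t c v u u' where eqs: "p = (a, s)" "q = (b, t)" "r = (c, v)"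
      and W: "s \<in> W" "t \<in> W" "v \<in> W" "u \<in> W" "u' \<in> W"
      and R: "a \<in> carrier R" "b \<in> carrier R" "c \<in> carrier R"
      and u: "u \<otimes> (a \<otimes> t) = u \<otimes> (b \<otimes> s)" and u': "u' \<otimes> (b \<otimes> v) = u' \<otimes> (c \<otimes> t)"
      by (cases p; cases q; cases r) (auto simp: fraction_rel_iff)
    note carr = R W[THEN mem_carrier]
    \<comment> \<open>The witness for transitivity is the product of both given witnesses and the
      middle denominator \<open>t\<close>, which occurs as a factor on the outer side of each
      hypothesis.\<close>
    have "(u \<otimes> u' \<otimes> t) \<otimes> (a \<otimes> v) = (u' \<otimes> v) \<otimes> (u \<otimes> (a \<otimes> t))"
      using carr by (simp add: m_ac)
    also have "\<dots> = (u \<otimes> s) \<otimes> (u' \<otimes> (b \<otimes> v))"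
      unfolding u using carr by (simp add: m_ac)
    also have "\<dots> = (u \<otimes> u' \<otimes> t) \<otimes> (c \<otimes> s)"
      unfolding u' using carr by (simp add: m_ac)
    finally show "(p, r) \<in> fraction_rel R W"
      unfolding eqs fraction_rel_iff using R W by blast
  qed
qed

lemma fraction_eq_iff:
  assumes "a \<in> carrier R" "s \<in> W" "b \<in> carrier R" "t \<in> W"
  shows "fraction R W a s = fraction R W b t \<longleftrightarrow> (\<exists>u\<in>W. u \<otimes> (a \<otimes> t) = u \<otimes> (b \<otimes> s))"
  unfolding fraction_def using assms
  by (subst eq_equiv_class_iff[OF equiv_fraction_rel]) (auto simp: fraction_rel_iff)

lemma fraction_eqI:
  assumes "a \<in> carrier R" "s \<in> W" "b \<in> carrier R" "t \<in> W" "a \<otimes> t = b \<otimes> s"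
  shows "fraction R W a s = fraction R W b t"
  using assms by (auto simp: fraction_eq_iff intro!: bexI[of _ \<one>])

lemma fraction_in_localization:
  "a \<in> carrier R \<Longrightarrow> s \<in> W \<Longrightarrow> fraction R W a s \<in> carrier (localization R W)"
  by (auto simp: localization_def fraction_def intro: quotientI)

lemma localizationE:
  assumes "x \<in> carrier (localization R W)"
  obtains a s where "a \<in> carrier R" "s \<in> W" "x = fraction R W a s"
  using assms by (auto simp: localization_def fraction_def elim!: quotientE)

lemma fraction_add_cong:
  assumes "((a, s), (a', s')) \<in> fraction_rel R W" "((b, t), (b', t')) \<in> fraction_rel R W"
  shows "fraction R W (a' \<otimes> t' \<oplus> b' \<otimes> s') (s' \<otimes> t') = fraction R W (a \<otimes> t \<oplus> b \<otimes> s) (s \<otimes> t)"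
proof -
  from assms obtain u v where W: "s \<in> W" "s' \<in> W" "t \<in> W" "t' \<in> W" "u \<in> W" "v \<in> W"
    and R: "a \<in> carrier R" "a' \<in> carrier R" "b \<in> carrier R" "b' \<in> carrier R"
    and u: "u \<otimes> (a \<otimes> s') = u \<otimes> (a' \<otimes> s)" and v: "v \<otimes> (b \<otimes> t') = v \<otimes> (b' \<otimes> t)"
    by (auto simp: fraction_rel_iff)
  note carr = R W[THEN mem_carrier]
  \<comment> \<open>The product of the two witnesses works: expanding the sum isolates one
    hypothesis in each summand.\<close>
  have "(u \<otimes> v) \<otimes> ((a' \<otimes> t' \<oplus> b' \<otimes> s') \<otimes> (s \<otimes> t)) =
      (v \<otimes> t \<otimes> t') \<otimes> (u \<otimes> (a' \<otimes> s)) \<oplus> (u \<otimes> s \<otimes> s') \<otimes> (v \<otimes> (b' \<otimes> t))"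
    using carr by algebra
  also have "\<dots> = (u \<otimes> v) \<otimes> ((a \<otimes> t \<oplus> b \<otimes> s) \<otimes> (s' \<otimes> t'))"
    unfolding u[symmetric] v[symmetric] using carr by algebra
  finally show ?thesis
    using R W by (subst fraction_eq_iff) (auto intro!: bexI[of _ "u \<otimes> v"])
qed

text \<open>By \<open>fraction_add_cong\<close> the unions that define addition run over a constant
  family. They collapse to its value because classes of fractions are nonempty.\<close>

lemma add_fraction:
  assumes "a \<in> carrier R" "s \<in> W" "b \<in> carrier R" "t \<in> W"
  shows "fraction R W a s \<oplus>\<^bsub>localization R W\<^esub> fraction R W b t =
    fraction R W (a \<otimes> t \<oplus> b \<otimes> s) (s \<otimes> t)"
proof -
  have "(a, s) \<in> fraction R W a s" "(b, t) \<in> fraction R W b t"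
    using assms by (auto simp: fraction_def fraction_rel_iff intro: one_closed)
  then have nonempty: "fraction R W a s \<noteq> {}" "fraction R W b t \<noteq> {}"
    by auto
  have "fraction R W (a' \<otimes> t' \<oplus> b' \<otimes> s') (s' \<otimes> t') =
      fraction R W (a \<otimes> t \<oplus> b \<otimes> s) (s \<otimes> t)"
    if "(a', s') \<in> fraction R W a s" "(b', t') \<in> fraction R W b t" for a' s' b' t'
    using that by (intro fraction_add_cong) (auto simp: fraction_def)
  then have "fraction R W a s \<oplus>\<^bsub>localization R W\<^esub> fraction R W b t =
      (\<Union>p\<in>fraction R W a s. \<Union>q\<in>fraction R W b t. fraction R W (a \<otimes> t \<oplus> b \<otimes> s) (s \<otimes> t))"
    unfolding localization_def ring_record_simps by (intro SUP_cong refl) (auto intro!: SUP_cong)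
  also have "\<dots> = fraction R W (a \<otimes> t \<oplus> b \<otimes> s) (s \<otimes> t)"
    using nonempty by simp
  finally show ?thesis .
qed

lemma zero_localization: "\<zero>\<^bsub>localization R W\<^esub> = fraction R W \<zero> \<one>"
  by (simp add: localization_def)

text \<open>Gives access to the \<open>finsum\<close> rules that evaluate
  \<open>reciprocal_sum\<close>.\<close>

lemma abelian_monoid_localization: "abelian_monoid (localization R W)"
proof (rule abelian_monoidI)
  show "\<zero>\<^bsub>localization R W\<^esub> \<in> carrier (localization R W)"
    by (simp add: zero_localization fraction_in_localization)
next
  fix x y assume "x \<in> carrier (localization R W)" "y \<in> carrier (localization R W)"
  then obtain a s b t where x: "a \<in> carrier R" "s \<in> W" "x = fraction R W a s"
    and y: "b \<in> carrier R" "t \<in> W" "y = fraction R W b t"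
    by (metis localizationE)
  show "x \<oplus>\<^bsub>localization R W\<^esub> y \<in> carrier (localization R W)"
    using x y by (simp add: add_fraction fraction_in_localization)
  show "x \<oplus>\<^bsub>localization R W\<^esub> y = y \<oplus>\<^bsub>localization R W\<^esub> x"
    using x y by (simp add: add_fraction a_comm m_comm)
next
  fix x assume "x \<in> carrier (localization R W)"
  then obtain a s where x: "a \<in> carrier R" "s \<in> W" "x = fraction R W a s"
    by (rule localizationE)
  then show "\<zero>\<^bsub>localization R W\<^esub> \<oplus>\<^bsub>localization R W\<^esub> x = x"
    by (simp add: zero_localization add_fraction)
next
  fix x y z
  assume "x \<in> carrier (localization R W)" "y \<in> carrier (localization R W)"
    "z \<in> carrier (localization R W)"
  then obtain a s b t c v where R: "a \<in> carrier R" "b \<in> carrier R" "c \<in> carrier R"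
    and W: "s \<in> W" "t \<in> W" "v \<in> W"
    and xyz: "x = fraction R W a s" "y = fraction R W b t" "z = fraction R W c v"
    by (metis localizationE)
  note carr = R W[THEN mem_carrier]
  have "(a \<otimes> t \<oplus> b \<otimes> s) \<otimes> v \<oplus> c \<otimes> (s \<otimes> t) = a \<otimes> (t \<otimes> v) \<oplus> (b \<otimes> v \<oplus> c \<otimes> t) \<otimes> s"
    using carr by algebra
  then show "x \<oplus>\<^bsub>localization R W\<^esub> y \<oplus>\<^bsub>localization R W\<^esub> z =
      x \<oplus>\<^bsub>localization R W\<^esub> (y \<oplus>\<^bsub>localization R W\<^esub> z)"
    using R W by (simp add: xyz add_fraction m_assoc)
qed

text \<open>Distinctness keeps \<open>{v, w}\<close> from collapsing to a set with a single
  summand.\<close>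

lemma reciprocal_sum_two:
  assumes "v \<in> W" "w \<in> W" "v \<noteq> w"
  shows "reciprocal_sum R W {v, w} = fraction R W (w \<oplus> v) (v \<otimes> w)"
proof -
  interpret L: abelian_monoid "localization R W"
    by (rule abelian_monoid_localization)
  have "fraction R W \<one> \<in> {v, w} \<rightarrow> carrier (localization R W)"
    using assms by (auto intro: fraction_in_localization)
  then show ?thesis
    using assms by (simp add: reciprocal_sum_def L.finsum_insert fraction_in_localization add_fraction)
qed

section \<open>Two reciprocals suffice\<close>

text \<open>Stated for a general \<open>w\<close> because it is applied both to \<open>j\<close> and
  to \<open>j \<otimes> j\<close>. The last assumption excludes exactly the case of equal
  denominators.\<close>

lemma fraction_eq_reciprocal_sum_two:
  assumes w: "w \<in> W" "w \<in> regular_elements R" "w \<in> jacobson_radical R"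
    and units: "Units R \<subseteq> W"
    and f: "f \<in> carrier R" "w \<otimes> f \<noteq> \<ominus> (\<one> \<oplus> \<one>)"
  shows "\<exists>S. finite S \<and> S \<subseteq> W \<and> card S \<le> 2 \<and> fraction R W f \<one> = reciprocal_sum R W S"
proof -
  have wR: "w \<in> carrier R"
    using w(1) by (rule mem_carrier)
  have u: "\<one> \<oplus> w \<otimes> f \<in> Units R"
    using w(3) f(1) by (intro one_plus_jacobson_radical_Units jacobson_radical_mult)
  define v where "v = inv (\<one> \<oplus> w \<otimes> f)"
  have vU: "v \<in> Units R"
    using u by (simp add: v_def)
  then have vR: "v \<in> carrier R"
    by (rule Units_closed)
  have v: "v \<otimes> (\<one> \<oplus> w \<otimes> f) = \<one>"
    using u by (simp add: v_def)
  \<comment> \<open>The negative of \<open>w\<close> lies in \<open>W\<close> as the product of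
    \<open>w\<close> with the unit \<open>\<ominus> \<one>\<close>.\<close>
  have "w \<otimes> \<ominus> \<one> \<in> W"
    using w(1) units by (intro m_closed) auto
  then have mem: "w \<otimes> v \<in> W" "\<ominus> w \<in> W"
    using w(1) vU units wR by (auto simp: r_minus)
  have ne: "w \<otimes> v \<noteq> \<ominus> w"
  proof
    assume "w \<otimes> v = \<ominus> w"
    then have "w \<otimes> v = w \<otimes> \<ominus> \<one>"
      using wR by (simp add: r_minus)
    then have "v = \<ominus> \<one>"
      using regular_elements_cancel[OF w(2) vR] by simp
    then have "\<ominus> \<one> \<otimes> (\<one> \<oplus> w \<otimes> f) = \<one>"
      using v by simp
    \<comment> \<open>Writing \<open>w \<otimes> f\<close> in terms of
      \<open>\<ominus> \<one> \<otimes> (\<one> \<oplus> w \<otimes> f)\<close> lets the preceding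
      equation be substituted.\<close>
    moreover have "w \<otimes> f = \<ominus> \<one> \<ominus> (\<ominus> \<one> \<otimes> (\<one> \<oplus> w \<otimes> f))"
      using wR f(1) by algebra
    ultimately have "w \<otimes> f = \<ominus> \<one> \<ominus> \<one>"
      by simp
    also have "\<dots> = \<ominus> (\<one> \<oplus> \<one>)"
      by algebra
    finally show False
      using f(2) by blast
  qed
  \<comment> \<open>This begins the cross-multiplied form of f = 1/(w v) + 1/(-w). The factor
    \<open>v \<otimes> (\<one> \<oplus> w \<otimes> f)\<close> is kept intact so that it can be
    replaced by \<open>\<one>\<close>.\<close>
  have "f \<otimes> ((w \<otimes> v) \<otimes> \<ominus> w) = w \<otimes> v \<ominus> w \<otimes> (v \<otimes> (\<one> \<oplus> w \<otimes> f))"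
    using wR vR f(1) by algebra
  also have "\<dots> = (\<ominus> w \<oplus> w \<otimes> v) \<otimes> \<one>"
    unfolding v using wR vR by algebra
  finally have "fraction R W f \<one> = fraction R W (\<ominus> w \<oplus> w \<otimes> v) ((w \<otimes> v) \<otimes> \<ominus> w)"
    using mem wR vR f(1) by (intro fraction_eqI) auto
  also have "\<dots> = reciprocal_sum R W {w \<otimes> v, \<ominus> w}"
    using mem ne by (simp add: reciprocal_sum_two)
  finally show ?thesis
    using mem by (intro exI[of _ "{w \<otimes> v, \<ominus> w}"]) (auto simp: card_insert_if)
qed

lemma fraction_eq_reciprocal_sum_card_le_two:
  assumes j: "j \<in> W" "j \<in> regular_elements R" "j \<in> jacobson_radical R"
    and units: "Units R \<subseteq> W"
    and f: "f \<in> carrier R" "f \<noteq> \<zero>"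
  shows "\<exists>S. finite S \<and> S \<subseteq> W \<and> card S \<le> 2 \<and> fraction R W f \<one> = reciprocal_sum R W S"
proof (cases "j \<otimes> f = \<ominus> (\<one> \<oplus> \<one>)")
  case False
  with assms show ?thesis
    by (intro fraction_eq_reciprocal_sum_two)
next
  case True
  have jR: "j \<in> carrier R"
    using j(1) by (rule mem_carrier)
  have "(j \<otimes> j) \<otimes> f \<noteq> \<ominus> (\<one> \<oplus> \<one>)"
  proof
    assume "(j \<otimes> j) \<otimes> f = \<ominus> (\<one> \<oplus> \<one>)"
    with True have "j \<otimes> (j \<otimes> f) = j \<otimes> f"
      using jR f(1) by (simp add: m_assoc)
    then have jf: "j \<otimes> f = f"
      using regular_elements_cancel[OF j(2)] jR f(1) by simp
    \<comment> \<open>The element 1 - j is written as \<open>\<one>\<close> plus a multiple of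
      \<open>j\<close>, the shape in which the unit criterion for the Jacobson radical
      applies.\<close>
    have "(\<one> \<oplus> j \<otimes> \<ominus> \<one>) \<otimes> f = f \<ominus> j \<otimes> f"
      using jR f(1) by algebra
    then have "(\<one> \<oplus> j \<otimes> \<ominus> \<one>) \<otimes> f = \<zero>"
      using jf f(1) by simp
    moreover have "\<one> \<oplus> j \<otimes> \<ominus> \<one> \<in> Units R"
      using j(3) by (intro one_plus_jacobson_radical_Units jacobson_radical_mult) auto
    ultimately have "f = \<zero>"
      using regular_elementsD Units_subset_regular_elements f(1) by blast
    with f(2) show False ..
  qed
  moreover have "j \<otimes> j \<in> regular_elements R"
    using submonoid.m_closed[OF submonoid_regular_elements] j(2) by blast
  ultimately show ?thesis
    using j(1,3) jR f(1) units
    by (intro fraction_eq_reciprocal_sum_two[of "j \<otimes> j"] jacobson_radical_mult) auto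
qed

text \<open>Kept general in \<open>W\<close> to serve both the generated multiplicative set and the
  set of all regular elements.\<close>

lemma strictly_egyptian_ring_wrtI:
  assumes "j \<in> W" "j \<in> regular_elements R" "j \<in> jacobson_radical R" "Units R \<subseteq> W"
  shows "strictly_egyptian_ring_wrt R W"
  unfolding strictly_egyptian_ring_wrt_def strictly_egyptian_element_def
    strictly_egyptian_fraction_def
  using fraction_eq_reciprocal_sum_card_le_two[OF assms]
  by (metis fraction_in_localization one_closed)

end

theorem theorem2p7:
  fixes R :: "('a, 'm) ring_scheme" and j :: 'a and W :: "'a set"
  assumes "cring R"
    and "j \<in> regular_elements R"
    and "j \<in> jacobson_radical R"
    and "W = generated_mult_set R (insert j (Units R))"
  shows "strictly_egyptian_ring_wrt R W \<and>
         strictly_egyptian_ring R \<and>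
         (\<forall>f \<in> carrier R. f \<noteq> \<zero>\<^bsub>R\<^esub> \<longrightarrow>
            (\<exists>S. finite S \<and> S \<subseteq> W \<and> card S \<le> 2 \<and>
               fraction R W f \<one>\<^bsub>R\<^esub> = reciprocal_sum R W S))"
proof -
  interpret cring R by fact
  have sub: "submonoid W R"
    unfolding assms(4) using regular_elements_closed[OF assms(2)]
    by (intro submonoid_generated_mult_set) auto
  interpret W: cring_mult_set R W
    by (intro cring_mult_set.intro assms(1) sub)
  \<comment> \<open>The two localizations are not compared. The same argument is run again with all
    regular elements as denominators.\<close>
  interpret reg: cring_mult_set R "regular_elements R"
    by (intro cring_mult_set.intro assms(1) submonoid_regular_elements)
  have gen: "j \<in> W" "Units R \<subseteq> W"
    using generated_mult_set_superset[of "insert j (Units R)" R] by (auto simp: assms(4))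
  have "strictly_egyptian_ring R"
    unfolding strictly_egyptian_ring_def
    \<comment> \<open>Regularity of \<open>j\<close> appears twice: once as membership in the
      multiplicative set and once as the regularity premise.\<close>
    using assms(2,2,3) Units_subset_regular_elements by (rule reg.strictly_egyptian_ring_wrtI)
  then show ?thesis
    using W.strictly_egyptian_ring_wrtI[OF gen(1) assms(2,3) gen(2)]
      W.fraction_eq_reciprocal_sum_card_le_two[OF gen(1) assms(2,3) gen(2)]
    by blast
qed

end
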